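(* Suppose that $p\in[0,1/2)$ and $\beta\in[4/7,1]$. Then for any $S_0\in\mathcal{D}$, $\xi$ started from $S_0$ is recurrent, that is, $$\mathbb{P}_{\beta,p}(\tau<\infty\mid\xi_0=S_0)=1 .$$
   Context: Configurations: let $\mathcal{D}'\subset\{0,1\}^{\mathbb{Z}}$ be the set of configurations with finitely many $0$'s to the left of the origin and finitely many $1$'s to the right. Call $S,S'\in\mathcal{D}'$ equivalent if they are translates of each other, and let $\mathcal{D}$ be the (countable) set of equivalence classes. So each $S\in\mathcal{D}$ is an infinite string of $1$'s, followed by a finite string of $0$'s and $1$'s, followed by an infinite string of $0$'s, modulo translation. The ground state is $\mathcal{D}_0=\ldots 111000\ldots$ (up to translation). An unlike pair is a pair of adjacent sites with labels $01$ or $10$ (read left to right); each configuration has finitely many of them and at least one. Process: for $\beta,p\in[0,1]$ the discrete-time exclusion-voter process $\xi=(\xi_t)_{t\in\mathbb{Z}^+}$, $\mathbb{Z}^+=\{0,1,2,\ldots\}$, is the time-homogeneous Markov chain on $\mathcal{D}$ with the following one-step dynamics. At each time step, independently, a voter move is chosen with probability $\beta$ and an exclusion move with probability $1-\beta$; then one of the unlike pairs of the current configuration is chosen uniformly at random. In a voter move the chosen pair is replaced by $00$ or by $11$, each with probability $1/2$. In an exclusion move, a chosen pair $01$ becomes $10$ with probability $p$ (otherwise no change), and a chosen pair $10$ becomes $01$ with probability $1-p$ (otherwise no change). Its law and expectation are denoted $\mathbb{P}_{\beta,p}$, $\mathbb{E}_{\beta,p}$. Relaxation time: $\tau=\min\{t\in\mathbb{N}:\xi_t=\mathcal{D}_0\}$,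 $\mathbb{N}=\{1,2,\ldots\}$, with $\tau=+\infty$ if there is no such $t$. *)

theory Defs
  imports "HOL-Probability.Probability"
begin

text \<open>Elements of \<open>{0,1}\<^sup>\<int>\<close> are functions of type \<open>int \<Rightarrow> bool\<close>, where \<^term>\<open>True\<close> stands
  for the label 1 and \<^term>\<open>False\<close> for the label 0.\<close>

definition step_like :: "(int \<Rightarrow> bool) set" where
  "step_like = {S. finite {x. x < 0 \<and> \<not> S x} \<and> finite {x. 0 < x \<and> S x}}"

definition translate :: "int \<Rightarrow> (int \<Rightarrow> bool) \<Rightarrow> int \<Rightarrow> bool" where
  "translate k S = (\<lambda>x. S (x + k))"

definition same_config :: "(int \<Rightarrow> bool) \<Rightarrow> (int \<Rightarrow> bool) \<Rightarrow> bool" where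
  "same_config S T \<longleftrightarrow> S \<in> step_like \<and> T \<in> step_like \<and> (\<exists>k. T = translate k S)"

lemma translate_translate: "translate k (translate l S) = translate (k + l) S"
  by (simp add: translate_def add.assoc)

lemma translate_0 [simp]: "translate 0 S = S"
  by (simp add: translate_def)

lemma translate_step_like:
  assumes "S \<in> step_like"
  shows "translate k S \<in> step_like"
proof -
  let ?A = "{x. x < 0 \<and> \<not> S x}" and ?B = "{x. 0 < x \<and> S x}"
  have "{x. x < 0 \<and> \<not> translate k S x} \<subseteq> (\<lambda>x. x - k) ` (?A \<union> {0..k})"
  proof
    fix x assume "x \<in> {x. x < 0 \<and> \<not> translate k S x}"
    then have "x + k \<in> ?A \<union> {0..k}" by (simp add: translate_def) linarith
    then show "x \<in> (\<lambda>x. x - k) ` (?A \<union> {0..k})" by (rule rev_image_eqI) simp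
  qed
  moreover have "{x. 0 < x \<and> translate k S x} \<subseteq> (\<lambda>x. x - k) ` (?B \<union> {k..0})"
  proof
    fix x assume "x \<in> {x. 0 < x \<and> translate k S x}"
    then have "x + k \<in> ?B \<union> {k..0}" by (simp add: translate_def) linarith
    then show "x \<in> (\<lambda>x. x - k) ` (?B \<union> {k..0})" by (rule rev_image_eqI) simp
  qed
  moreover have "finite ((\<lambda>x. x - k) ` (?A \<union> {0..k}))" "finite ((\<lambda>x. x - k) ` (?B \<union> {k..0}))"
    using assms by (simp_all add: step_like_def)
  ultimately show ?thesis
    unfolding step_like_def mem_Collect_eq by (intro conjI) (rule finite_subset; assumption)+
qed

lemma same_config_part_equivp: "part_equivp same_config"
proof (rule part_equivpI)
  have "(\<lambda>x::int. x \<le> 0) \<in> step_like"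
  proof -
    have *: "{x::int. x < 0 \<and> \<not> x \<le> 0} = {}" "{x::int. 0 < x \<and> x \<le> 0} = {}"
      by auto
    show ?thesis by (simp add: step_like_def *)
  qed
  moreover have "(\<lambda>x::int. x \<le> 0) = translate 0 (\<lambda>x::int. x \<le> 0)" by simp
  ultimately show "\<exists>S. same_config S S"
    unfolding same_config_def by blast
  show "symp same_config"
  proof (rule sympI)
    fix S T assume "same_config S T"
    then obtain k where k: "S \<in> step_like" "T \<in> step_like" "T = translate k S"
      by (auto simp: same_config_def)
    then have "S = translate (- k) T" by (simp add: translate_translate)
    with k(1,2) show "same_config T S" unfolding same_config_def by blast
  qed
  show "transp same_config"
    unfolding same_config_def by (rule transpI) (metis translate_translate)
qed

quotient_type config = "int \<Rightarrow> bool" / partial: same_config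
  by (rule same_config_part_equivp)

lift_definition ground_state :: config is "\<lambda>x. x \<le> 0"
proof -
  have *: "{x::int. x < 0 \<and> \<not> x \<le> 0} = {}" "{x::int. 0 < x \<and> x \<le> 0} = {}"
    by auto
  show "same_config (\<lambda>x. x \<le> 0) (\<lambda>x. x \<le> 0)"
    by (auto simp: same_config_def step_like_def * intro: exI[of _ 0])
qed

lemma countable_step_like: "countable step_like"
proof -
  let ?f = "\<lambda>S::int \<Rightarrow> bool. ({x. x < 0 \<and> \<not> S x}, {x. 0 < x \<and> S x}, S 0)"
  let ?F = "{A :: int set. finite A}"
  have "inj_on ?f step_like"
  proof (rule inj_onI, rule ext)
    fix S T :: "int \<Rightarrow> bool" and x :: int
    assume "?f S = ?f T"
    then have "x \<in> {x. x < 0 \<and> \<not> S x} \<longleftrightarrow> x \<in> {x. x < 0 \<and> \<not> T x}"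
      "x \<in> {x. 0 < x \<and> S x} \<longleftrightarrow> x \<in> {x. 0 < x \<and> T x}" "S 0 = T 0"
      by (simp_all only: prod.inject)
    then show "S x = T x"
      by (cases x "0 :: int" rule: linorder_cases) simp_all
  qed
  moreover have "countable (?f ` step_like)"
  proof (rule countable_subset)
    show "?f ` step_like \<subseteq> ?F \<times> ?F \<times> UNIV"
      by (auto simp: step_like_def)
    show "countable (?F \<times> ?F \<times> (UNIV :: bool set))"
      using countable_Collect_finite by (intro countable_SIGMA) auto
  qed
  ultimately show ?thesis
    by (rule countable_image_inj_on[rotated])
qed

instance config :: countable
proof
  have "countable (UNIV :: config set)"
  proof (rule countable_subset)
    show "(UNIV :: config set) \<subseteq> abs_config ` step_like"
    proof
      fix c :: config
      show "c \<in> abs_config ` step_like"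
        by (rule config.abs_induct[of _ c]) (auto simp: same_config_def)
    qed
    show "countable (abs_config ` step_like)"
      using countable_step_like by simp
  qed
  then show "\<exists>to_nat :: config \<Rightarrow> nat. inj to_nat"
    by (simp add: countable_def)
qed

text \<open>The unlike pair formed by the sites \<open>x\<close> and \<open>x + 1\<close> is identified with \<open>x\<close>.\<close>

definition unlike_pairs :: "(int \<Rightarrow> bool) \<Rightarrow> int set" where
  "unlike_pairs S = {x. S x \<noteq> S (x + 1)}"

definition voter_move :: "(int \<Rightarrow> bool) \<Rightarrow> int \<Rightarrow> (int \<Rightarrow> bool) pmf" where
  "voter_move S x = map_pmf (\<lambda>b. S(x := b, x + 1 := b)) (bernoulli_pmf (1 / 2))"

text \<open>At an unlike pair, \<open>S x\<close> alone tells 10 (swapped with probability \<open>1 - p\<close>) from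
  01 (swapped with probability \<open>p\<close>).\<close>

definition exclusion_move :: "real \<Rightarrow> (int \<Rightarrow> bool) \<Rightarrow> int \<Rightarrow> (int \<Rightarrow> bool) pmf" where
  "exclusion_move p S x =
     map_pmf (\<lambda>swap. if swap then S(x := S (x + 1), x + 1 := S x) else S)
       (bernoulli_pmf (if S x then 1 - p else p))"

definition raw_step :: "real \<Rightarrow> real \<Rightarrow> (int \<Rightarrow> bool) \<Rightarrow> (int \<Rightarrow> bool) pmf" where
  "raw_step \<beta> p S =
     bind_pmf (bernoulli_pmf \<beta>) (\<lambda>voter.
     bind_pmf (pmf_of_set (unlike_pairs S)) (\<lambda>x.
       if voter then voter_move S x else exclusion_move p S x))"

text \<open>The following lemmas ensure that \<^const>\<open>pmf_of_set\<close> and \<^const>\<open>abs_config\<close> are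
  only applied where they are meaningful.\<close>

lemma step_like_bounds:
  assumes "S \<in> step_like"
  obtains a b where "a < b" "\<And>x. x \<le> a \<Longrightarrow> S x" "\<And>x. b \<le> x \<Longrightarrow> \<not> S x"
proof -
  let ?A = "{x. x < 0 \<and> \<not> S x}" and ?B = "{x. 0 < x \<and> S x}"
  have fin: "finite ?A" "finite ?B" using assms by (auto simp: step_like_def)
  define a where "a = Min (insert 0 ?A) - 1"
  define b where "b = Max (insert 0 ?B) + 1"
  have a: "\<forall>x\<in>insert 0 ?A. a < x"
  proof
    fix x assume "x \<in> insert 0 ?A"
    then have "Min (insert 0 ?A) \<le> x" by (intro Min_le finite.insertI fin(1))
    then show "a < x" unfolding a_def by linarith
  qed
  have b: "\<forall>x\<in>insert 0 ?B. x < b"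
  proof
    fix x assume "x \<in> insert 0 ?B"
    then have "x \<le> Max (insert 0 ?B)" by (intro Max_ge finite.insertI fin(2))
    then show "x < b" unfolding b_def by linarith
  qed
  show thesis
  proof
    show "a < b" using a b by force
    show "S x" if "x \<le> a" for x
    proof (rule ccontr)
      assume "\<not> S x"
      moreover have "x < 0" using a that by simp
      ultimately have "a < x" using a by blast
      with that show False by simp
    qed
    show "\<not> S x" if "b \<le> x" for x
    proof
      assume "S x"
      moreover have "0 < x" using b that by simp
      ultimately have "x < b" using b by blast
      with that show False by simp
    qed
  qed
qed

lemma finite_unlike_pairs:
  assumes "S \<in> step_like"
  shows "finite (unlike_pairs S)"
proof -
  obtain a b where ab: "\<And>x. x \<le> a \<Longrightarrow> S x" "\<And>x. b \<le> x \<Longrightarrow> \<not> S x"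
    using step_like_bounds[OF assms] by metis
  have "unlike_pairs S \<subseteq> {a - 1..b}"
  proof
    fix x assume "x \<in> unlike_pairs S"
    then show "x \<in> {a - 1..b}"
      using ab(1)[of x] ab(1)[of "x + 1"] ab(2)[of x] ab(2)[of "x + 1"]
      by (force simp: unlike_pairs_def)
  qed
  then show ?thesis by (rule finite_subset) simp
qed

lemma unlike_pairs_nonempty:
  assumes "S \<in> step_like"
  shows "unlike_pairs S \<noteq> {}"
proof
  assume empty: "unlike_pairs S = {}"
  obtain a b where ab: "a < b" "\<And>x. x \<le> a \<Longrightarrow> S x" "\<And>x. b \<le> x \<Longrightarrow> \<not> S x"
    using step_like_bounds[OF assms] by metis
  have "S x" if "a \<le> x" for x
    using that empty by (induction x rule: int_ge_induct) (auto simp: ab(2) unlike_pairs_def)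
  then show False using ab(1) ab(3)[of b] by force
qed

lemma step_like_finite_change:
  assumes "S \<in> step_like" and "finite {x. T x \<noteq> S x}"
  shows "T \<in> step_like"
proof -
  have "{x. x < 0 \<and> \<not> T x} \<subseteq> {x. x < 0 \<and> \<not> S x} \<union> {x. T x \<noteq> S x}"
    "{x. 0 < x \<and> T x} \<subseteq> {x. 0 < x \<and> S x} \<union> {x. T x \<noteq> S x}"
    by auto
  then show ?thesis
    using assms unfolding step_like_def mem_Collect_eq
    by (meson finite_UnI finite_subset)
qed

lemma raw_step_step_like:
  assumes "S \<in> step_like" and "T \<in> set_pmf (raw_step \<beta> p S)"
  shows "T \<in> step_like"
proof -
  obtain voter x where "T \<in> set_pmf (if voter then voter_move S x else exclusion_move p S x)"
    using assms(2) unfolding raw_step_def set_bind_pmf by blast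
  then have x: "T y = S y" if "y \<noteq> x" "y \<noteq> x + 1" for y
    using that by (auto simp: voter_move_def exclusion_move_def split: if_splits)
  have "{y. T y \<noteq> S y} \<subseteq> {x, x + 1}" using x by auto
  then have "finite {y. T y \<noteq> S y}" by (rule finite_subset) simp
  with assms(1) show ?thesis by (rule step_like_finite_change)
qed

lemma unlike_pairs_translate: "unlike_pairs (translate k S) = (\<lambda>x. x - k) ` unlike_pairs S"
proof (intro equalityI subsetI)
  fix x assume "x \<in> unlike_pairs (translate k S)"
  then have "x + k \<in> unlike_pairs S"
    by (simp add: unlike_pairs_def translate_def ac_simps)
  then show "x \<in> (\<lambda>x. x - k) ` unlike_pairs S"
    by (rule rev_image_eqI) simp
next
  fix x assume "x \<in> (\<lambda>x. x - k) ` unlike_pairs S"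
  then show "x \<in> unlike_pairs (translate k S)"
    by (auto simp: unlike_pairs_def translate_def algebra_simps)
qed

lemma translate_upd: "(translate k S)(x - k := a, x - k + 1 := b) = translate k (S(x := a, x + 1 := b))"
  by (auto simp: translate_def fun_eq_iff)

lemma voter_move_translate:
  "voter_move (translate k S) (x - k) = map_pmf (translate k) (voter_move S x)"
  unfolding voter_move_def map_pmf_comp by (simp only: translate_upd)

lemma exclusion_move_translate:
  "exclusion_move p (translate k S) (x - k) = map_pmf (translate k) (exclusion_move p S x)"
proof -
  have eq: "translate k S (x - k) = S x" "translate k S (x - k + 1) = S (x + 1)"
    by (simp_all add: translate_def)
  show ?thesis
    unfolding exclusion_move_def map_pmf_comp eq translate_upd
    by (intro map_pmf_cong refl) auto
qed

lemma raw_step_translate: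
  assumes "S \<in> step_like"
  shows "raw_step \<beta> p (translate k S) = map_pmf (translate k) (raw_step \<beta> p S)"
proof -
  have "pmf_of_set (unlike_pairs (translate k S)) =
      map_pmf (\<lambda>x. x - k) (pmf_of_set (unlike_pairs S))"
    unfolding unlike_pairs_translate
    using assms by (intro map_pmf_of_set_inj[symmetric])
      (auto simp: inj_on_def finite_unlike_pairs unlike_pairs_nonempty)
  then show ?thesis
    unfolding raw_step_def
    by (auto simp: bind_map_pmf map_bind_pmf voter_move_translate exclusion_move_translate
        intro!: bind_pmf_cong)
qed

lift_definition step :: "real \<Rightarrow> real \<Rightarrow> config \<Rightarrow> config pmf"
  is "\<lambda>\<beta> p S. map_pmf abs_config (raw_step \<beta> p S)"
proof -
  fix \<beta> p :: real and S T
  assume "same_config S T"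
  then obtain k where k: "S \<in> step_like" "T = translate k S"
    by (auto simp: same_config_def)
  have "abs_config (translate k U) = abs_config U" if "U \<in> set_pmf (raw_step \<beta> p S)" for U
  proof -
    have "U \<in> step_like" using k(1) that by (rule raw_step_step_like)
    then have "same_config U (translate k U)"
      by (auto simp: same_config_def translate_step_like)
    then show ?thesis
      by (rule Quotient3_rel_abs[OF Quotient3_config, symmetric])
  qed
  then show "map_pmf abs_config (raw_step \<beta> p S) = map_pmf abs_config (raw_step \<beta> p T)"
    unfolding k(2) raw_step_translate[OF k(1)] map_pmf_comp
    by (intro map_pmf_cong) auto
qed

definition markov_chain ::
    "'w measure \<Rightarrow> ('s::countable \<Rightarrow> 's pmf) \<Rightarrow> (nat \<Rightarrow> 'w \<Rightarrow> 's) \<Rightarrow> bool" where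
  "markov_chain M K X \<longleftrightarrow>
     prob_space M \<and>
     (\<forall>t. X t \<in> measurable M (count_space UNIV)) \<and>
     (\<forall>t x. \<P>(\<omega> in M. \<forall>i\<le>t. X i \<omega> = x i) > 0 \<longrightarrow>
        \<P>(\<omega> in M. X (Suc t) \<omega> = x (Suc t) \<bar> \<forall>i\<le>t. X i \<omega> = x i)
          = pmf (K (x t)) (x (Suc t)))"

definition exclusion_voter :: "real \<Rightarrow> real \<Rightarrow> 'w measure \<Rightarrow> (nat \<Rightarrow> 'w \<Rightarrow> config) \<Rightarrow> bool" where
  "exclusion_voter \<beta> p M \<xi> \<longleftrightarrow> markov_chain M (step \<beta> p) \<xi>"

text \<open>An infimum over the empty set is \<^term>\<open>\<infinity> :: enat\<close>.\<close>

definition relaxation_time :: "(nat \<Rightarrow> 'w \<Rightarrow> config) \<Rightarrow> 'w \<Rightarrow> enat" where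
  "relaxation_time \<xi> \<omega> = (INF t\<in>{t. 1 \<le> t \<and> \<xi> t \<omega> = ground_state}. enat t)"

end

theory Submission
  imports Defs "HOL-Real_Asymp.Real_Asymp"
begin

text \<open>The proof is a Lyapunov argument. Let \<open>I\<close> be the number of inversions of a configuration, that is,
  of pairs consisting of a 0 and a 1 somewhere to its right; \<open>I = 0\<close> exactly in the ground state.
  The function \<open>ln (1 + I)\<close> is a supermartingale away from the ground state, and it tends to
  infinity with \<open>I\<close>. Since \<open>I\<close> also drops at each such step with a probability that is bounded below
  on every set \<open>{I < R}\<close>, the chain cannot stay in such a set; and the supermartingale
  property makes the probability of leaving it before reaching the ground state at most
  \<open>ln (1 + I) / ln (1 + R)\<close>, which vanishes as \<open>R\<close> grows.

  For the drift, put \<open>F = 1 + I\<close> and let there be \<open>N\<close> pairs 01, hence \<open>N + 1\<close> pairs 10. Write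
  \<open>A\<close> and \<open>B\<close> for the numbers of 0's to the left and of 1's to the right of a site. An exclusion
  move changes \<open>I\<close> by at most one, upwards only at a pair 10. A voter move at a pair 01 changes \<open>I\<close>
  by \<open>-1\<close> on average. A voter move at a pair 10 changes \<open>I\<close> by \<open>A - B\<close> or \<open>B - A\<close>; this is 0 on
  average, but concavity of the logarithm yields a contribution of at most
  \<open>- (A - B)\<^sup>2 / (2 F\<^sup>2)\<close>. At the leftmost pair 10 there is \<open>A = 0\<close> and at the rightmost one
  \<open>B = 0\<close>; by the inequality of arithmetic and geometric means these two pairs alone contribute at
  most \<open>- a b / F\<^sup>2\<close>, where \<open>a\<close> is the value of \<open>A\<close> at the rightmost and \<open>b\<close> that of \<open>B\<close> at the
  leftmost one, and \<open>a b \<ge> I = F - 1\<close>. In total \<open>(2 N + 1) F\<close> times the drift is at most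
  \<open>(1 - 2 \<beta>) (N + 1) + \<beta> / F\<close>. If \<open>\<beta> \<ge> 1/2\<close>, this is
  largest at \<open>N = 1\<close> and \<open>F = 2\<close>, with the value \<open>2 - 7 \<beta> / 2\<close>, which is nonpositive if and only
  if \<open>\<beta> \<ge> 4/7\<close>.

  The drift bound is \<open>ln_inversions_drift\<close>, the descent is \<open>inversions_decrease\<close>, the abstract
  criterion is \<open>avoid_tendsto_0\<close>, and \<open>markov_chain_returns\<close> transfers its conclusion from the
  transition kernel to the given chain.\<close>

section \<open>A Lyapunov criterion for hitting a state\<close>

text \<open>The probability that the chain with kernel \<open>K\<close>, started at \<open>c\<close>, does not visit \<open>z\<close> at
  the times \<open>0, \<dots>, n\<close>. Defining it by first-step analysis allows the Lyapunov argument to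
  be carried out on the kernel, without a probability space of trajectories.\<close>
primrec avoid :: "('s \<Rightarrow> 's pmf) \<Rightarrow> 's \<Rightarrow> nat \<Rightarrow> 's \<Rightarrow> real" where
  "avoid K z 0 c = (if c = z then 0 else 1)"
| "avoid K z (Suc n) c = (if c = z then 0 else measure_pmf.expectation (K c) (avoid K z n))"

lemma integrable_pmf_unit_interval:
  fixes f :: "'s \<Rightarrow> real"
  assumes "\<And>y. f y \<in> {0..1}"
  shows "integrable (measure_pmf P) f"
  by (rule measure_pmf.integrable_const_bound[where B = 1]) (use assms in auto)

lemma avoid_range: "avoid K z n c \<in> {0..1}"
proof (induction n arbitrary: c)
  case (Suc n)
  have "measure_pmf.expectation (K c) (avoid K z n) \<le> measure_pmf.expectation (K c) (\<lambda>_. 1)"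
    by (rule integral_mono) (use Suc in \<open>auto intro: integrable_pmf_unit_interval\<close>)
  moreover have "0 \<le> measure_pmf.expectation (K c) (avoid K z n)"
    by (rule integral_nonneg_AE) (use Suc in auto)
  ultimately show ?case by simp
qed simp

lemma integrable_avoid: "integrable (measure_pmf P) (avoid K z n)"
  by (rule integrable_pmf_unit_interval) (rule avoid_range)

lemma avoid_Suc_le: "avoid K z (Suc n) c \<le> avoid K z n c"
proof (induction n arbitrary: c)
  case 0
  then show ?case using avoid_range[of K z "Suc 0" c] by (cases "c = z") simp_all
next
  case (Suc n)
  have "measure_pmf.expectation (K c) (avoid K z (Suc n)) \<le> measure_pmf.expectation (K c) (avoid K z n)"
    by (rule integral_mono[OF integrable_avoid integrable_avoid]) (rule Suc.IH)
  then show ?case by (metis avoid.simps(2) order.refl)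
qed

lemma expectation_avoid_tendsto:
  assumes "\<And>y. (\<lambda>n. avoid K z n y) \<longlonglongrightarrow> w y"
  shows "(\<lambda>n. measure_pmf.expectation P (avoid K z n)) \<longlonglongrightarrow> measure_pmf.expectation P w"
proof (rule integral_dominated_convergence[where w = "\<lambda>_. 1"])
  show "AE y in measure_pmf P. norm (avoid K z n y) \<le> 1" for n
    using avoid_range[of K z n] by (auto intro!: AE_pmfI)
qed (use assms in auto)

text \<open>Let \<open>w\<close> be the probability of never visiting \<open>z\<close>; it is harmonic off \<open>z\<close>, so
  \<open>G = w - \<epsilon> H\<close> is subharmonic there, while \<open>G \<le> 0\<close> at \<open>z\<close> and wherever \<open>f\<close> is large. A maximum
  principle shows \<open>G \<le> 0\<close> everywhere, and \<open>\<epsilon>\<close> is arbitrary. The state space may be infinite even on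
  the sublevel sets of \<open>f\<close>, so a maximum of \<open>G\<close> need not be attained; instead, the chance \<open>\<delta>\<close> of
  decreasing \<open>f\<close> keeps \<open>G\<close> away from a positive supremum \<open>s\<close> by an amount depending only on the
  level of \<open>f\<close>.\<close>
lemma avoid_tendsto_0:
  fixes K :: "'s \<Rightarrow> 's pmf" and f :: "'s \<Rightarrow> nat" and H \<delta> :: "nat \<Rightarrow> real"
  assumes H_nonneg: "\<And>n. 0 \<le> H n"
    and H_lim: "filterlim H at_top sequentially"
    and H_int: "\<And>c. integrable (K c) (\<lambda>y. H (f y))"
    and drift: "\<And>c. c \<noteq> z \<Longrightarrow> measure_pmf.expectation (K c) (\<lambda>y. H (f y)) \<le> H (f c)"
    and \<delta>_pos: "\<And>n. 0 < \<delta> n"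
    and decrease: "\<And>c. c \<noteq> z \<Longrightarrow> \<delta> (f c) \<le> measure_pmf.prob (K c) {y. f y < f c}"
  shows "(\<lambda>n. avoid K z n c) \<longlonglongrightarrow> 0"
proof -
  define w where "w c = lim (\<lambda>n. avoid K z n c)" for c
  have w: "(\<lambda>n. avoid K z n c) \<longlonglongrightarrow> w c" for c
  proof -
    have "decseq (\<lambda>n. avoid K z n c)" by (rule decseq_SucI) (rule avoid_Suc_le)
    then obtain l where "(\<lambda>n. avoid K z n c) \<longlonglongrightarrow> l"
      by (rule decseq_convergent[where B = 0]) (use avoid_range[of K z _ c] in auto)
    then show ?thesis unfolding w_def by (simp add: limI)
  qed
  have w01: "w c \<in> {0..1}" for c
    by (rule closed_sequentially[OF _ _ w]) (use avoid_range[of K z _ c] in auto)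
  have w_z: "w z = 0"
  proof -
    have "avoid K z n z = 0" for n by (cases n) auto
    then show ?thesis by (simp add: w_def)
  qed
  have w_step: "w c = measure_pmf.expectation (K c) w" if "c \<noteq> z" for c
  proof (rule LIMSEQ_unique)
    show "(\<lambda>n. avoid K z (Suc n) c) \<longlonglongrightarrow> w c" by (rule LIMSEQ_Suc[OF w])
    show "(\<lambda>n. avoid K z (Suc n) c) \<longlonglongrightarrow> measure_pmf.expectation (K c) w"
      using expectation_avoid_tendsto[OF w] that by simp
  qed
  have le: "w c \<le> \<epsilon> * H (f c)" if "0 < \<epsilon>" for \<epsilon> c
  proof (rule ccontr)
    assume neg: "\<not> w c \<le> \<epsilon> * H (f c)"
    define G where "G c = w c - \<epsilon> * H (f c)" for c
    define s where "s = (SUP c. G c)"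
    have G_le1: "G c \<le> 1" for c
    proof -
      have "0 \<le> \<epsilon> * H (f c)" using that H_nonneg by simp
      then show ?thesis using w01[of c] unfolding G_def atLeastAtMost_iff by linarith
    qed
    have bdd: "bdd_above (range G)" by (rule bdd_aboveI2) (rule G_le1)
    have G_le_s: "G c \<le> s" for c unfolding s_def by (rule cSUP_upper[OF _ bdd]) simp
    have "0 < G c" using neg by (simp add: G_def)
    then have s_pos: "0 < s" using G_le_s[of c] by linarith
    obtain R where R: "\<And>n. n \<ge> R \<Longrightarrow> H n \<ge> 1 / \<epsilon>"
      using H_lim unfolding filterlim_at_top eventually_sequentially by blast
    have G_far: "G c \<le> 0" if "R \<le> f c" for c
    proof -
      have "1 \<le> \<epsilon> * H (f c)" using R[OF that] \<open>0 < \<epsilon>\<close> by (simp add: field_simps)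
      then show ?thesis using w01[of c] by (simp add: G_def)
    qed
    define d where "d = Min (insert 1 (\<delta> ` {..<R}))"
    have d: "0 < d" "d \<le> 1" "\<And>k. k < R \<Longrightarrow> d \<le> \<delta> k"
      unfolding d_def using \<delta>_pos by (auto simp: Min_gr_iff)
    have dpow: "0 \<le> s * (1 - d ^ k)" for k
      using s_pos d by (simp add: power_le_one)
    \<comment> \<open>A path that decreases \<open>f\<close> at each of at most \<open>k\<close> steps has probability at least \<open>d ^ k\<close>
      and ends where \<open>G \<le> 0\<close>; on the rest \<open>G \<le> s\<close>.\<close>
    have level: "G c \<le> s * (1 - d ^ k)" if "f c \<le> k" for k c
      using that
    proof (induction k arbitrary: c)
      case 0
      have "c = z"
      proof (rule ccontr)
        assume "c \<noteq> z"
        with decrease[of c] \<delta>_pos[of 0] 0 show False by simp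
      qed
      then show ?case using H_nonneg[of "f z"] that w_z \<open>0 < \<epsilon>\<close> by (simp add: G_def)
    next
      case (Suc k)
      consider "c = z" | "R \<le> f c" | "c \<noteq> z" "f c < R" by linarith
      then show ?case
      proof cases
        case 1
        then have "G c \<le> 0" using H_nonneg[of "f z"] w_z \<open>0 < \<epsilon>\<close> by (simp add: G_def)
        then show ?thesis using dpow[of "Suc k"] by linarith
      next
        case 2
        then show ?thesis using G_far[of c] dpow[of "Suc k"] by linarith
      next
        case 3
        let ?E = "measure_pmf.expectation (K c)" and ?A = "{y. f y < f c}"
        have int_w: "integrable (K c) w" by (rule integrable_pmf_unit_interval) (rule w01)
        have int_G: "integrable (K c) G"
          unfolding G_def by (intro Bochner_Integration.integrable_diff integrable_mult_right int_w H_int)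
        have int_A: "integrable (K c) (indicator ?A :: 's \<Rightarrow> real)"
          by (rule integrable_pmf_unit_interval) (simp add: indicator_def)
        have "?E G = w c - \<epsilon> * ?E (\<lambda>y. H (f y))"
          unfolding G_def using int_w H_int w_step[OF 3(1)] by simp
        then have "G c \<le> ?E G"
          using drift[OF 3(1)] \<open>0 < \<epsilon>\<close> by (simp add: G_def)
        also have "\<dots> \<le> ?E (\<lambda>y. s - s * d ^ k * indicator ?A y)"
        proof (rule integral_mono[OF int_G])
          show "integrable (K c) (\<lambda>y. s - s * d ^ k * indicator ?A y)"
            by (intro Bochner_Integration.integrable_diff integrable_mult_right int_A) simp
          show "G y \<le> s - s * d ^ k * indicator ?A y" for y
            using Suc.IH[of y] Suc.prems G_le_s[of y] by (auto simp: indicator_def algebra_simps)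
        qed
        also have "\<dots> = s - s * d ^ k * measure_pmf.prob (K c) ?A"
          by (simp add: Bochner_Integration.integral_diff[OF _ integrable_mult_right[OF int_A]])
        also have "\<dots> \<le> s - s * d ^ k * d"
          using d(3)[OF 3(2)] decrease[OF 3(1)] d(1) s_pos by (intro diff_left_mono mult_left_mono) auto
        finally show ?thesis by (simp add: algebra_simps)
      qed
    qed
    have "G c \<le> s * (1 - d ^ R)" for c
      using level[of c R] G_far[of c] dpow[of R] by (cases "f c \<le> R") auto
    then have "s \<le> s * (1 - d ^ R)"
      unfolding s_def by (intro cSUP_least) auto
    moreover have "0 < s * d ^ R" using s_pos d(1) by simp
    ultimately show False by (simp add: algebra_simps)
  qed
  have "w c \<le> 0" for c
  proof (rule field_le_epsilon)
    fix e :: real assume "0 < e"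
    have "w c \<le> e / (1 + H (f c)) * H (f c)"
      using le[of "e / (1 + H (f c))" c] \<open>0 < e\<close> H_nonneg[of "f c"] by simp
    also have "\<dots> \<le> e"
      using \<open>0 < e\<close> H_nonneg[of "f c"] by (simp add: field_simps)
    finally show "w c \<le> 0 + e" by simp
  qed
  then have "w c = 0" using w01[of c] by (simp add: antisym)
  then show ?thesis using w[of c] by simp
qed

section \<open>Hitting probabilities of a Markov chain\<close>

lemma markov_chain_path_Suc:
  assumes "markov_chain M K X"
  shows "\<P>(\<omega> in M. \<forall>i\<le>Suc t. X i \<omega> = x i) = \<P>(\<omega> in M. \<forall>i\<le>t. X i \<omega> = x i) * pmf (K (x t)) (x (Suc t))"
proof -
  interpret prob_space M using assms by (simp add: markov_chain_def)
  have [measurable]: "X i \<in> measurable M (count_space UNIV)" for i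
    using assms by (simp add: markov_chain_def)
  have eq: "\<P>(\<omega> in M. \<forall>i\<le>Suc t. X i \<omega> = x i) = \<P>(\<omega> in M. X (Suc t) \<omega> = x (Suc t) \<and> (\<forall>i\<le>t. X i \<omega> = x i))"
    by (rule arg_cong[where f = "measure M"]) (auto simp: le_Suc_eq)
  show ?thesis
  proof (cases "\<P>(\<omega> in M. \<forall>i\<le>t. X i \<omega> = x i) = 0")
    case True
    have "\<P>(\<omega> in M. X (Suc t) \<omega> = x (Suc t) \<and> (\<forall>i\<le>t. X i \<omega> = x i)) \<le> \<P>(\<omega> in M. \<forall>i\<le>t. X i \<omega> = x i)"
      by (rule finite_measure_mono) auto
    then show ?thesis using True measure_nonneg[of M] eq by (simp add: measure_le_0_iff)
  next
    case False
    then have pos: "\<P>(\<omega> in M. \<forall>i\<le>t. X i \<omega> = x i) > 0"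
      by (simp add: zero_less_measure_iff)
    then have "\<P>(\<omega> in M. X (Suc t) \<omega> = x (Suc t) \<bar> \<forall>i\<le>t. X i \<omega> = x i) = pmf (K (x t)) (x (Suc t))"
      using assms unfolding markov_chain_def by blast
    then show ?thesis using pos unfolding cond_prob_def eq by (simp add: field_simps)
  qed
qed

text \<open>A bound that holds for every value of the next state, relative to the probability of the
  path, can be averaged over that state by the Markov property. This is used both along a path
  and for the first step, which must be separate because the start may be the target itself.\<close>
lemma markov_chain_one_step:
  fixes X :: "nat \<Rightarrow> 'w \<Rightarrow> 's::countable"
  assumes mc: "markov_chain M K X"
    and E: "Measurable.pred M E"
    and g: "\<And>y. g y \<in> {0..1}"
    and le: "\<And>y. \<P>(\<omega> in M. (\<forall>i\<le>Suc t. X i \<omega> = (x(Suc t := y)) i) \<and> E \<omega>)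
        \<le> \<P>(\<omega> in M. \<forall>i\<le>Suc t. X i \<omega> = (x(Suc t := y)) i) * g y"
  shows "\<P>(\<omega> in M. (\<forall>i\<le>t. X i \<omega> = x i) \<and> E \<omega>)
    \<le> \<P>(\<omega> in M. \<forall>i\<le>t. X i \<omega> = x i) * measure_pmf.expectation (K (x t)) g"
proof -
  interpret prob_space M using mc by (simp add: markov_chain_def)
  have [measurable]: "X i \<in> measurable M (count_space UNIV)" for i
    using mc by (simp add: markov_chain_def)
  note E[measurable]
  let ?Q = "\<P>(\<omega> in M. \<forall>i\<le>t. X i \<omega> = x i)"
  let ?D = "\<lambda>y. {\<omega> \<in> space M. (\<forall>i\<le>Suc t. X i \<omega> = (x(Suc t := y)) i) \<and> E \<omega>}"
  have D: "measure M (?D y) \<le> ?Q * (pmf (K (x t)) y * g y)" for y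
  proof -
    have "(\<forall>i\<le>t. X i \<omega> = (x(Suc t := y)) i) \<longleftrightarrow> (\<forall>i\<le>t. X i \<omega> = x i)" for \<omega>
      by auto
    then show ?thesis
      using le[of y] unfolding markov_chain_path_Suc[OF mc] by (simp only:) (simp add: mult.assoc)
  qed
  have "{\<omega> \<in> space M. (\<forall>i\<le>t. X i \<omega> = x i) \<and> E \<omega>} = (\<Union>y. ?D y)"
    by (auto simp: le_Suc_eq)
  then have "emeasure M {\<omega> \<in> space M. (\<forall>i\<le>t. X i \<omega> = x i) \<and> E \<omega>}
      = (\<integral>\<^sup>+y. emeasure M (?D y) \<partial>count_space UNIV)"
    by (simp only:, intro emeasure_UN_countable)
      (auto simp: disjoint_family_on_def)
  also have "\<dots> \<le> (\<integral>\<^sup>+y. ennreal ?Q * (ennreal (pmf (K (x t)) y) * ennreal (g y)) \<partial>count_space UNIV)"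
    by (rule nn_integral_mono)
      (use g D in \<open>simp add: emeasure_eq_measure ennreal_mult[symmetric] ennreal_leI del: fun_upd_apply\<close>)
  also have "\<dots> = ennreal ?Q * (\<integral>\<^sup>+y. ennreal (g y) \<partial>K (x t))"
    by (simp add: nn_integral_cmult nn_integral_measure_pmf)
  also have "(\<integral>\<^sup>+y. ennreal (g y) \<partial>K (x t)) = ennreal (measure_pmf.expectation (K (x t)) g)"
    by (rule nn_integral_eq_integral) (use g in \<open>auto intro: integrable_pmf_unit_interval\<close>)
  finally show ?thesis
    using g by (simp add: emeasure_eq_measure ennreal_mult[symmetric] integral_nonneg_AE)
qed

lemma markov_chain_avoid:
  fixes X :: "nat \<Rightarrow> 'w \<Rightarrow> 's::countable"
  assumes mc: "markov_chain M K X"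
  shows "\<P>(\<omega> in M. (\<forall>i\<le>t. X i \<omega> = x i) \<and> (\<forall>i\<in>{t..t+n}. X i \<omega> \<noteq> z))
    \<le> \<P>(\<omega> in M. \<forall>i\<le>t. X i \<omega> = x i) * avoid K z n (x t)"
proof (induction n arbitrary: t x)
  interpret prob_space M using mc by (simp add: markov_chain_def)
  have X[measurable]: "X i \<in> measurable M (count_space UNIV)" for i
    using mc by (simp add: markov_chain_def)
  have at_z: "\<P>(\<omega> in M. (\<forall>i\<le>t. X i \<omega> = x i) \<and> (\<forall>i\<in>{t..t+n}. X i \<omega> \<noteq> z)) = 0" if "x t = z" for n t x
  proof -
    have "{\<omega> \<in> space M. (\<forall>i\<le>t. X i \<omega> = x i) \<and> (\<forall>i\<in>{t..t+n}. X i \<omega> \<noteq> z)} = {}"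
      using that by force
    then show ?thesis by (simp only: measure_empty)
  qed
  {
    case 0
    show ?case
    proof (cases "x t = z")
      case True
      then show ?thesis using at_z[of x t 0] by simp
    next
      case False
      then show ?thesis by (auto intro!: finite_measure_mono)
    qed
  next
    case (Suc n)
    show ?case
    proof (cases "x t = z")
      case True
      then show ?thesis using at_z[of x t "Suc n"] by simp
    next
      case False
      have "\<P>(\<omega> in M. (\<forall>i\<le>t. X i \<omega> = x i) \<and> (\<forall>i\<in>{t..t+Suc n}. X i \<omega> \<noteq> z))
        \<le> \<P>(\<omega> in M. (\<forall>i\<le>t. X i \<omega> = x i) \<and> (\<forall>i\<in>{Suc t..Suc t+n}. X i \<omega> \<noteq> z))"
        by (rule finite_measure_mono) auto
      also have "\<dots> \<le> \<P>(\<omega> in M. \<forall>i\<le>t. X i \<omega> = x i) * measure_pmf.expectation (K (x t)) (avoid K z n)"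
      proof (rule markov_chain_one_step[OF mc _ avoid_range])
        show "Measurable.pred M (\<lambda>\<omega>. \<forall>i\<in>{Suc t..Suc t + n}. X i \<omega> \<noteq> z)"
          by measurable
        show "\<P>(\<omega> in M. (\<forall>i\<le>Suc t. X i \<omega> = (x(Suc t := y)) i) \<and> (\<forall>i\<in>{Suc t..Suc t+n}. X i \<omega> \<noteq> z))
          \<le> \<P>(\<omega> in M. \<forall>i\<le>Suc t. X i \<omega> = (x(Suc t := y)) i) * avoid K z n y" for y
          using Suc[of "Suc t" "x(Suc t := y)"] by simp
      qed
      finally show ?thesis using False by simp
    qed
  }
qed

text \<open>Return times are at least 1, so the chain may start at \<open>z\<close>: the first step is made
  unconditionally, and only from then on is \<^const>\<open>avoid\<close> applied.\<close>
lemma markov_chain_returns: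
  fixes X :: "nat \<Rightarrow> 'w \<Rightarrow> 's::countable"
  assumes mc: "markov_chain M K X"
    and lim: "\<And>c. (\<lambda>n. avoid K z n c) \<longlonglongrightarrow> 0"
    and pos: "\<P>(\<omega> in M. X 0 \<omega> = c) > 0"
  shows "\<P>(\<omega> in M. (\<exists>t\<ge>1. X t \<omega> = z) \<bar> X 0 \<omega> = c) = 1"
proof -
  interpret prob_space M using mc by (simp add: markov_chain_def)
  have X[measurable]: "X i \<in> measurable M (count_space UNIV)" for i
    using mc by (simp add: markov_chain_def)
  let ?N = "{\<omega> \<in> space M. X 0 \<omega> = c \<and> (\<forall>t\<ge>1. X t \<omega> \<noteq> z)}"
  have le: "prob ?N \<le> \<P>(\<omega> in M. X 0 \<omega> = c) * measure_pmf.expectation (K c) (avoid K z n)" for n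
  proof -
    have "prob ?N \<le> \<P>(\<omega> in M. (\<forall>i\<le>0. X i \<omega> = c) \<and> (\<forall>i\<in>{Suc 0..Suc 0+n}. X i \<omega> \<noteq> z))"
      by (rule finite_measure_mono) auto
    also have "\<dots> \<le> \<P>(\<omega> in M. \<forall>i\<le>0. X i \<omega> = c) * measure_pmf.expectation (K c) (avoid K z n)"
    proof (rule markov_chain_one_step[OF mc _ avoid_range, where x = "\<lambda>_. c"])
      show "Measurable.pred M (\<lambda>\<omega>. \<forall>i\<in>{Suc 0..Suc 0 + n}. X i \<omega> \<noteq> z)"
        by measurable
      show "\<P>(\<omega> in M. (\<forall>i\<le>Suc 0. X i \<omega> = ((\<lambda>_. c)(Suc 0 := y)) i) \<and> (\<forall>i\<in>{Suc 0..Suc 0+n}. X i \<omega> \<noteq> z))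
        \<le> \<P>(\<omega> in M. \<forall>i\<le>Suc 0. X i \<omega> = ((\<lambda>_. c)(Suc 0 := y)) i) * avoid K z n y" for y
        using markov_chain_avoid[OF mc, of "Suc 0" "(\<lambda>_. c)(Suc 0 := y)" n z] by simp
    qed
    finally show ?thesis by simp
  qed
  have "(\<lambda>n. measure_pmf.expectation (K c) (avoid K z n)) \<longlonglongrightarrow> 0"
    using expectation_avoid_tendsto[OF lim, of "K c"] by simp
  then have "(\<lambda>n. \<P>(\<omega> in M. X 0 \<omega> = c) * measure_pmf.expectation (K c) (avoid K z n)) \<longlonglongrightarrow> 0"
    by (rule tendsto_mult_right_zero)
  then have "prob ?N \<le> 0"
    by (rule LIMSEQ_le_const) (use le in auto)
  then have N0: "prob ?N = 0" using measure_nonneg[of M ?N] by linarith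
  have "\<P>(\<omega> in M. X 0 \<omega> = c) = prob ({\<omega> \<in> space M. (\<exists>t\<ge>1. X t \<omega> = z) \<and> X 0 \<omega> = c} \<union> ?N)"
    by (rule arg_cong[where f = prob]) auto
  also have "\<dots> = \<P>(\<omega> in M. (\<exists>t\<ge>1. X t \<omega> = z) \<and> X 0 \<omega> = c) + prob ?N"
    by (rule finite_measure_Union) auto
  finally show ?thesis using pos N0 by (simp add: cond_prob_def)
qed

section \<open>Inversions of a configuration\<close>

definition inversion_set :: "(int \<Rightarrow> bool) \<Rightarrow> (int \<times> int) set" where
  "inversion_set S = {(x, y). x < y \<and> \<not> S x \<and> S y}"

definition zeros_left :: "(int \<Rightarrow> bool) \<Rightarrow> int \<Rightarrow> int set" where
  "zeros_left S x = {y. y < x \<and> \<not> S y}"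

definition ones_right :: "(int \<Rightarrow> bool) \<Rightarrow> int \<Rightarrow> int set" where
  "ones_right S x = {y. x < y \<and> S y}"

abbreviation inv_count :: "(int \<Rightarrow> bool) \<Rightarrow> nat" where
  "inv_count S \<equiv> card (inversion_set S)"

lemma step_like_label_bounds:
  assumes "S \<in> step_like"
  obtains a b where "a < b" "\<And>x. \<not> S x \<Longrightarrow> a < x" "\<And>x. S x \<Longrightarrow> x < b"
proof -
  obtain a b where ab: "a < b" "\<And>x. x \<le> a \<Longrightarrow> S x" "\<And>x. b \<le> x \<Longrightarrow> \<not> S x"
    using step_like_bounds[OF assms] by metis
  show thesis
  proof (rule that[of a b])
    show "a < x" if "\<not> S x" for x using ab(2)[of x] that by (cases "a < x") auto
    show "x < b" if "S x" for x using ab(3)[of x] that by (cases "x < b") auto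
  qed (rule ab(1))
qed

lemma finite_zeros_left:
  assumes "S \<in> step_like"
  shows "finite (zeros_left S x)"
proof -
  obtain a b where "a < b" "\<And>x. \<not> S x \<Longrightarrow> a < x" "\<And>x. S x \<Longrightarrow> x < b"
    using step_like_label_bounds[OF assms] by metis
  then have "zeros_left S x \<subseteq> {a<..<x}" by (auto simp: zeros_left_def)
  then show ?thesis by (rule finite_subset) simp
qed

lemma finite_ones_right:
  assumes "S \<in> step_like"
  shows "finite (ones_right S x)"
proof -
  obtain a b where "a < b" "\<And>x. \<not> S x \<Longrightarrow> a < x" "\<And>x. S x \<Longrightarrow> x < b"
    using step_like_label_bounds[OF assms] by metis
  then have "ones_right S x \<subseteq> {x<..<b}" by (auto simp: ones_right_def)
  then show ?thesis by (rule finite_subset) simp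
qed

lemma finite_inversion_set:
  assumes "S \<in> step_like"
  shows "finite (inversion_set S)"
proof -
  obtain a b where ab: "a < b" "\<And>x. \<not> S x \<Longrightarrow> a < x" "\<And>x. S x \<Longrightarrow> x < b"
    using step_like_label_bounds[OF assms] by metis
  have "inversion_set S \<subseteq> {a<..<b} \<times> {a<..<b}"
    by (auto simp: inversion_set_def dest: ab(2,3)) (meson ab(2,3) order.strict_trans)+
  then show ?thesis by (rule finite_subset) simp
qed

lemma step_like_upd: "S \<in> step_like \<Longrightarrow> S(x := b) \<in> step_like"
  by (rule step_like_finite_change[of S]) (auto intro: finite_subset[of _ "{x}"])

lemma inv_count_translate: "inv_count (translate k S) = inv_count S"
proof (rule bij_betw_same_card)
  show "bij_betw (\<lambda>(x, y). (x + k, y + k)) (inversion_set (translate k S)) (inversion_set S)"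
    by (rule bij_betw_byWitness[where f' = "\<lambda>(x, y). (x - k, y - k)"])
      (auto simp: inversion_set_def translate_def)
qed

text \<open>Turning a 1 at \<open>x\<close> into a 0 destroys its inversions with the 0's to the left and creates
  inversions with the 1's to the right; inversions not involving \<open>x\<close> are unaffected. All changes
  of the number of inversions under the dynamics are compositions of such flips.\<close>
lemma inv_count_flip:
  assumes S: "S \<in> step_like" and x: "S x"
  shows "inv_count (S(x := False)) + card (zeros_left S x) = inv_count S + card (ones_right S x)"
proof -
  let ?C = "{(y, z). y < z \<and> \<not> S y \<and> S z \<and> y \<noteq> x \<and> z \<noteq> x}"
  have C: "finite ?C"
    by (rule finite_subset[OF _ finite_inversion_set[OF S]]) (auto simp: inversion_set_def)
  have 1: "inversion_set S = ?C \<union> (\<lambda>y. (y, x)) ` zeros_left S x"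
    using x by (auto simp: inversion_set_def zeros_left_def image_iff)
  have 2: "inversion_set (S(x := False)) = ?C \<union> (\<lambda>y. (x, y)) ` ones_right S x"
    using x by (auto simp: inversion_set_def ones_right_def image_iff split: if_splits)
  have "inv_count S = card ?C + card (zeros_left S x)"
    unfolding 1 using C finite_zeros_left[OF S]
    by (subst card_Un_disjoint) (auto simp: card_image inj_on_def zeros_left_def)
  moreover have "inv_count (S(x := False)) = card ?C + card (ones_right S x)"
    unfolding 2 using C finite_ones_right[OF S]
    by (subst card_Un_disjoint) (auto simp: card_image inj_on_def ones_right_def)
  ultimately show ?thesis by simp
qed

definition site_imbalance :: "(int \<Rightarrow> bool) \<Rightarrow> int \<Rightarrow> real" where
  "site_imbalance S x = real (card (zeros_left S x)) - real (card (ones_right S x))"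

lemma inv_count_unset:
  assumes "S \<in> step_like" and "S x"
  shows "real (inv_count (S(x := False))) = real (inv_count S) - site_imbalance S x"
  using inv_count_flip[OF assms] unfolding site_imbalance_def by linarith

lemma inv_count_set:
  assumes S: "S \<in> step_like" and x: "\<not> S x"
  shows "real (inv_count (S(x := True))) = real (inv_count S) + site_imbalance S x"
proof -
  have "S(x := True, x := False) = S" using x by (simp add: fun_upd_idem)
  moreover have "zeros_left (S(x := True)) x = zeros_left S x" "ones_right (S(x := True)) x = ones_right S x"
    by (auto simp: zeros_left_def ones_right_def)
  ultimately show ?thesis
    using inv_count_unset[of "S(x := True)" x] step_like_upd[OF S, of x True]
    by (simp add: site_imbalance_def)
qed

lemma zeros_left_Suc: "zeros_left S (x + 1) = (if S x then zeros_left S x else insert x (zeros_left S x))"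
  by (auto simp: zeros_left_def) (metis order_le_less)

lemma ones_right_Suc: "ones_right S x = (if S (x + 1) then insert (x + 1) (ones_right S (x + 1)) else ones_right S (x + 1))"
  by (auto simp: ones_right_def) (metis add1_zle_eq order_le_less)+

lemma site_imbalance_Suc:
  assumes "S \<in> step_like"
  shows "site_imbalance S (x + 1) = site_imbalance S x + of_bool (\<not> S x) + of_bool (S (x + 1))"
proof -
  have "x \<notin> zeros_left S x" "x + 1 \<notin> ones_right S (x + 1)"
    by (auto simp: zeros_left_def ones_right_def)
  then show ?thesis
    unfolding site_imbalance_def zeros_left_Suc ones_right_Suc[of S x]
    using assms by (auto simp: finite_zeros_left finite_ones_right)
qed

lemma inv_count_swap_10:
  assumes S: "S \<in> step_like" and x: "S x" "\<not> S (x + 1)"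
  shows "real (inv_count (S(x := False, x + 1 := True))) = real (inv_count S) + 1"
proof -
  let ?T = "S(x := False)"
  have T: "?T \<in> step_like" by (rule step_like_upd[OF S])
  have "zeros_left ?T x = zeros_left S x" "ones_right ?T x = ones_right S x"
    by (auto simp: zeros_left_def ones_right_def)
  then have "site_imbalance ?T (x + 1) = site_imbalance S x + 1"
    unfolding site_imbalance_Suc[OF T] using x by (simp add: site_imbalance_def)
  then show ?thesis
    using inv_count_set[OF T, of "x + 1"] inv_count_unset[OF S x(1)] x(2) by simp
qed

lemma inv_count_swap_01:
  assumes S: "S \<in> step_like" and x: "\<not> S x" "S (x + 1)"
  shows "real (inv_count (S(x := True, x + 1 := False))) = real (inv_count S) - 1"
proof -
  let ?T = "S(x := True, x + 1 := False)"
  have "?T \<in> step_like" by (intro step_like_upd S)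
  moreover have "?T(x := False, x + 1 := True) = S" using x by (auto simp: fun_eq_iff)
  ultimately show ?thesis using inv_count_swap_10[of ?T x] by simp
qed

text \<open>Only one of the two sites changes its label, and at a pair 10 both sites have the same
  imbalance. The two outcomes of the voter move are therefore opposite.\<close>
lemma inv_count_voter_10:
  assumes S: "S \<in> step_like" and x: "S x" "\<not> S (x + 1)"
  shows "real (inv_count (S(x := False, x + 1 := False))) = real (inv_count S) - site_imbalance S x"
    and "real (inv_count (S(x := True, x + 1 := True))) = real (inv_count S) + site_imbalance S x"
proof -
  have "S(x := False, x + 1 := False) = S(x := False)" "S(x := True, x + 1 := True) = S(x + 1 := True)"
    using x by (auto simp: fun_eq_iff)
  then show "real (inv_count (S(x := False, x + 1 := False))) = real (inv_count S) - site_imbalance S x"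
    and "real (inv_count (S(x := True, x + 1 := True))) = real (inv_count S) + site_imbalance S x"
    using inv_count_unset[OF S x(1)] inv_count_set[OF S x(2)] site_imbalance_Suc[OF S, of x] x
    by simp_all
qed

text \<open>At a pair 01 the imbalance grows by 2 from the left site to the right one, as each site
  counts for the other. Hence the two outcomes add up to \<open>-2\<close> instead of cancelling.\<close>
lemma inv_count_voter_01:
  assumes S: "S \<in> step_like" and x: "\<not> S x" "S (x + 1)"
  shows "real (inv_count (S(x := False, x + 1 := False))) + real (inv_count (S(x := True, x + 1 := True)))
    = 2 * real (inv_count S) - 2"
proof -
  have "S(x := False, x + 1 := False) = S(x + 1 := False)" "S(x := True, x + 1 := True) = S(x := True)"
    using x by (auto simp: fun_eq_iff)
  then show ?thesis
    using inv_count_set[OF S x(1)] inv_count_unset[OF S x(2)] site_imbalance_Suc[OF S, of x] x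
    by simp
qed

definition pairs_10 :: "(int \<Rightarrow> bool) \<Rightarrow> int set" where
  "pairs_10 S = {x. S x \<and> \<not> S (x + 1)}"

definition pairs_01 :: "(int \<Rightarrow> bool) \<Rightarrow> int set" where
  "pairs_01 S = {x. \<not> S x \<and> S (x + 1)}"

lemma unlike_pairs_split:
  "unlike_pairs S = pairs_10 S \<union> pairs_01 S" "pairs_10 S \<inter> pairs_01 S = {}"
  by (auto simp: unlike_pairs_def pairs_10_def pairs_01_def)

lemma finite_pairs:
  assumes "S \<in> step_like"
  shows "finite (pairs_10 S)" "finite (pairs_01 S)"
  using finite_unlike_pairs[OF assms] by (simp_all add: unlike_pairs_split(1))

text \<open>From left to right the labels step down from 1 to 0 in total, so there is one more descent than there
  are ascents.\<close>
lemma card_pairs_10: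
  assumes "S \<in> step_like"
  shows "card (pairs_10 S) = card (pairs_01 S) + 1"
proof -
  obtain a b where ab: "a < b" "\<And>x. x \<le> a \<Longrightarrow> S x" "\<And>x. b \<le> x \<Longrightarrow> \<not> S x"
    using step_like_bounds[OF assms] by metis
  let ?g = "\<lambda>x. of_bool (S x) :: int"
  have telescope: "(\<Sum>x\<in>{a..<c}. ?g x - ?g (x + 1)) = ?g a - ?g c" if "a \<le> c" for c
    using that
  proof (induction c rule: int_ge_induct)
    case (step c)
    have "{a..<c + 1} = insert c {a..<c}" using step(1) by auto
    then show ?case using step by simp
  qed simp
  have sub: "pairs_10 S \<subseteq> {a..<b}" "pairs_01 S \<subseteq> {a..<b}"
    using ab(2,3) by (auto simp: pairs_10_def pairs_01_def) (smt (verit))+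
  have "(\<Sum>x\<in>{a..<b}. ?g x - ?g (x + 1))
      = (\<Sum>x\<in>{a..<b}. of_bool (x \<in> pairs_10 S) - of_bool (x \<in> pairs_01 S))"
    by (rule sum.cong) (auto simp: pairs_10_def pairs_01_def)
  also have "\<dots> = int (card (pairs_10 S)) - int (card (pairs_01 S))"
    using sub by (simp add: sum_subtractf of_bool_def sum.If_cases Int_absorb1)
  finally show ?thesis using telescope[of b] ab by simp
qed

lemma card_pairs_01_le:
  assumes "S \<in> step_like"
  shows "card (pairs_01 S) \<le> inv_count S"
proof -
  have "card (pairs_01 S) = card ((\<lambda>x. (x, x + 1)) ` pairs_01 S)"
    by (rule card_image[symmetric]) (auto simp: inj_on_def)
  also have "\<dots> \<le> inv_count S"
    by (rule card_mono[OF finite_inversion_set[OF assms]]) (auto simp: pairs_01_def inversion_set_def)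
  finally show ?thesis .
qed

text \<open>All 0's lie to the right of the site \<open>l\<close> of the leftmost pair 10, and no 1 lies to the right of
  the site \<open>r\<close> of the rightmost one: each inversion consists of a 0 to the left of \<open>r\<close> and a 1 to the right of
  \<open>l\<close>. This product bound is what makes the quadratic terms of the drift comparable with the
  number of inversions.\<close>
lemma outermost_pairs_10:
  assumes S: "S \<in> step_like" and pos: "0 < inv_count S"
  obtains l r where "l \<in> pairs_10 S" "r \<in> pairs_10 S" "l \<noteq> r" "pairs_01 S \<noteq> {}"
    "zeros_left S l = {}" "ones_right S r = {}"
    "inv_count S \<le> card (zeros_left S r) * card (ones_right S l)"
proof -
  obtain x y where xy: "x < y" "\<not> S x" "S y"
    using pos by (fastforce simp: card_gt_0_iff inversion_set_def)
  obtain a b where ab: "a < b" "\<And>x. \<not> S x \<Longrightarrow> a < x" "\<And>x. S x \<Longrightarrow> x < b"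
    using step_like_label_bounds[OF S] by metis
  define Z where "Z = {x. \<not> S x \<and> x \<le> b}"
  define W where "W = {x. S x \<and> a \<le> x}"
  have "Z \<subseteq> {a<..b}" "W \<subseteq> {a..<b}"
    by (auto simp: Z_def W_def ab(2,3))
  then have fin: "finite Z" "finite W" by (auto intro: finite_subset)
  have ne: "Z \<noteq> {}" "W \<noteq> {}" using ab(1) ab(2)[of a] ab(3)[of b] by (auto simp: Z_def W_def)
  define l where "l = Min Z - 1"
  define r where "r = Max W"
  have l1: "\<not> S (l + 1)" using Min_in[OF fin(1) ne(1)] by (simp add: l_def Z_def)
  have l2: "S u" if "u \<le> l" for u
  proof (rule ccontr)
    assume "\<not> S u"
    then have "u \<in> Z \<or> b < u" by (auto simp: Z_def)
    moreover have "l < b" using Min_in[OF fin(1) ne(1)] by (simp add: l_def Z_def)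
    ultimately show False using that Min_le[OF fin(1), of u] by (auto simp: l_def)
  qed
  have r1: "S r" using Max_in[OF fin(2) ne(2)] by (simp add: r_def W_def)
  have r2: "\<not> S u" if "r < u" for u
  proof
    assume "S u"
    then have "u \<in> W \<or> u < a" by (auto simp: W_def)
    moreover have "a \<le> r" using Max_in[OF fin(2) ne(2)] by (simp add: r_def W_def)
    ultimately show False using that Max_ge[OF fin(2), of u] by (auto simp: r_def)
  qed
  have l3: "l < u" if "\<not> S u" for u using l2[of u] that by (cases "l < u") auto
  have r3: "u \<le> r" if "S u" for u using r2[of u] that by (cases "u \<le> r") auto
  have lr: "l < r" using xy(1) l3[OF xy(2)] r3[OF xy(3)] by linarith
  have "pairs_01 S \<noteq> {}"
  proof
    assume empty: "pairs_01 S = {}"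
    have "\<not> S u" if "x \<le> u" for u
      using that by (induction u rule: int_ge_induct) (use xy empty in \<open>auto simp: pairs_01_def\<close>)
    then show False using xy by auto
  qed
  moreover have "inv_count S \<le> card (zeros_left S r) * card (ones_right S l)"
  proof -
    have "inversion_set S \<subseteq> zeros_left S r \<times> ones_right S l"
    proof clarify
      fix u v assume "(u, v) \<in> inversion_set S"
      then have uv: "u < v" "\<not> S u" "S v" by (auto simp: inversion_set_def)
      then have "v \<le> r" "l < u" using r3[of v] l3[of u] by simp_all
      then show "u \<in> zeros_left S r \<and> v \<in> ones_right S l"
        using uv by (auto simp: zeros_left_def ones_right_def)
    qed
    then have "inv_count S \<le> card (zeros_left S r \<times> ones_right S l)"
      by (intro card_mono finite_cartesian_product finite_zeros_left finite_ones_right S)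
    then show ?thesis by (simp add: card_cartesian_product)
  qed
  ultimately show thesis
    using l1 l2 r1 r2 lr by (intro that[of l r]) (auto simp: pairs_10_def zeros_left_def ones_right_def)
qed

lift_definition inversions :: "config \<Rightarrow> nat" is inv_count
  by (auto simp: same_config_def inv_count_translate)

lemma same_config_refl: "S \<in> step_like \<Longrightarrow> same_config S S"
  by (auto simp: same_config_def intro: exI[of _ 0])

lemma inversions_abs: "S \<in> step_like \<Longrightarrow> inversions (abs_config S) = inv_count S"
  by (rule inversions.abs_eq) (simp add: same_config_refl eq_onp_def)

lemma config_cases:
  obtains S where "S \<in> step_like" "c = abs_config S"
  by (rule config.abs_induct[of "\<lambda>d. d = c \<longrightarrow> thesis" c, THEN mp]) (auto simp: same_config_def)

lemma inversions_eq_0D: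
  assumes "inversions c = 0"
  shows "c = ground_state"
proof -
  obtain S where S: "S \<in> step_like" and c: "c = abs_config S" by (rule config_cases)
  have empty: "inversion_set S = {}"
    using assms S finite_inversion_set[OF S] by (simp add: c inversions_abs)
  have mono: "S u" if "u \<le> v" "S v" for u v
  proof (rule ccontr)
    assume "\<not> S u"
    then have "(u, v) \<in> inversion_set S"
      using that by (auto simp: inversion_set_def order_le_less)
    then show False using empty by simp
  qed
  obtain k where k: "S k" "\<not> S (k + 1)"
  proof -
    have "pairs_10 S \<noteq> {}" using card_pairs_10[OF S] by force
    then show thesis using that by (auto simp: pairs_10_def)
  qed
  have "S x \<longleftrightarrow> x \<le> k" for x
  proof (cases "x \<le> k")
    case True
    then show ?thesis using mono[OF True k(1)] by simp
  next
    case False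
    then have "k + 1 \<le> x" by simp
    then show ?thesis using mono[of "k + 1" x] k(2) False by blast
  qed
  then have "translate k S = (\<lambda>x. x \<le> 0)" by (simp add: translate_def)
  then have "same_config S (\<lambda>x. x \<le> 0)"
    using S translate_step_like[OF S, of k] unfolding same_config_def by metis
  then show ?thesis unfolding c ground_state_def
    by (rule Quotient3_rel_abs[OF Quotient3_config])
qed

section \<open>One step of the process\<close>

text \<open>The mean of \<open>\<phi>\<close> of the number of inversions after one step, given that the pair at \<open>x\<close> has
  been chosen.\<close>
definition pair_mean :: "real \<Rightarrow> real \<Rightarrow> (nat \<Rightarrow> real) \<Rightarrow> (int \<Rightarrow> bool) \<Rightarrow> int \<Rightarrow> real" where
  "pair_mean \<beta> p \<phi> S x =
     \<beta> * ((\<phi> (inv_count (S(x := True, x + 1 := True))) + \<phi> (inv_count (S(x := False, x + 1 := False)))) / 2)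
   + (1 - \<beta>) * (let r = if S x then 1 - p else p
       in r * \<phi> (inv_count (S(x := S (x + 1), x + 1 := S x))) + (1 - r) * \<phi> (inv_count S))"

lemma finite_set_raw_step:
  assumes "S \<in> step_like"
  shows "finite (set_pmf (raw_step \<beta> p S))"
  using finite_unlike_pairs[OF assms] unlike_pairs_nonempty[OF assms]
  by (auto simp: raw_step_def voter_move_def exclusion_move_def)

lemma finite_set_step: "finite (set_pmf (step \<beta> p c))"
proof -
  obtain S where S: "S \<in> step_like" and c: "c = abs_config S" by (rule config_cases)
  show ?thesis
    unfolding c step.abs_eq[OF same_config_refl[OF S]]
    using finite_set_raw_step[OF S] by simp
qed

lemma expectation_step:
  fixes \<phi> :: "nat \<Rightarrow> real"
  assumes p: "p \<in> {0..1}" and \<beta>: "\<beta> \<in> {0..1}" and S: "S \<in> step_like"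
  shows "measure_pmf.expectation (step \<beta> p (abs_config S)) (\<lambda>c. \<phi> (inversions c))
    = (\<Sum>x\<in>unlike_pairs S. pair_mean \<beta> p \<phi> S x) / card (unlike_pairs S)"
proof -
  let ?h = "\<lambda>T. \<phi> (inv_count T)" and ?U = "unlike_pairs S"
  let ?move = "\<lambda>voter x. if voter then voter_move S x else exclusion_move p S x"
  have U: "finite ?U" "?U \<noteq> {}"
    using finite_unlike_pairs[OF S] unlike_pairs_nonempty[OF S] by auto
  have fin: "finite (set_pmf (?move voter x))" for voter x
    by (auto simp: voter_move_def exclusion_move_def)
  have "measure_pmf.expectation (step \<beta> p (abs_config S)) (\<lambda>c. \<phi> (inversions c))
      = measure_pmf.expectation (raw_step \<beta> p S) (\<lambda>T. \<phi> (inversions (abs_config T)))"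
    unfolding step.abs_eq[OF same_config_refl[OF S]] by simp
  also have "\<dots> = measure_pmf.expectation (raw_step \<beta> p S) ?h"
    by (intro integral_cong_AE AE_pmfI) (auto simp: inversions_abs dest: raw_step_step_like[OF S])
  also have "\<dots> = (\<Sum>voter\<in>UNIV. pmf (bernoulli_pmf \<beta>) voter *
      measure_pmf.expectation (pmf_of_set ?U \<bind> ?move voter) ?h)"
    unfolding raw_step_def
    by (subst pmf_expectation_bind[of UNIV]) (use U fin in auto)
  also have "\<dots> = (\<Sum>voter\<in>UNIV. pmf (bernoulli_pmf \<beta>) voter *
      (\<Sum>x\<in>?U. measure_pmf.expectation (?move voter x) ?h / card ?U))"
    by (subst pmf_expectation_bind_pmf_of_set) (use U fin in \<open>auto simp: divide_inverse_commute\<close>)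
  also have "\<dots> = (\<Sum>x\<in>?U. (\<beta> * measure_pmf.expectation (voter_move S x) ?h
      + (1 - \<beta>) * measure_pmf.expectation (exclusion_move p S x) ?h) / card ?U)"
    using \<beta> by (simp add: UNIV_bool sum_distrib_left sum.distrib[symmetric] add_divide_distrib add.commute)
  also have "\<dots> = (\<Sum>x\<in>?U. pair_mean \<beta> p \<phi> S x / card ?U)"
  proof -
    have "measure_pmf.expectation (voter_move S x) ?h =
        (?h (S(x := True, x + 1 := True)) + ?h (S(x := False, x + 1 := False))) / 2" for x
      unfolding voter_move_def integral_map_pmf by (subst integral_bernoulli_pmf) simp_all
    moreover have "measure_pmf.expectation (exclusion_move p S x) ?h =
        (let r = if S x then 1 - p else p
         in r * ?h (S(x := S (x + 1), x + 1 := S x)) + (1 - r) * ?h S)" for x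
      unfolding exclusion_move_def integral_map_pmf Let_def
      by (subst integral_bernoulli_pmf) (use p in \<open>simp_all add: mult.commute\<close>)
    ultimately show ?thesis by (simp only: pair_mean_def)
  qed
  finally show ?thesis by (simp add: sum_divide_distrib)
qed

section \<open>The drift of the logarithm\<close>

lemma ln_le_tangent:
  fixes u F :: real
  assumes "0 < u" "0 < F"
  shows "ln u \<le> ln F + (u - F) / F"
  using ln_le_minus_one[of "u / F"] assms by (simp add: ln_div diff_divide_distrib)

lemma pair_mean_ln_01:
  assumes S: "S \<in> step_like" and x: "x \<in> pairs_01 S"
    and p: "p \<in> {0..1}" and \<beta>: "\<beta> \<in> {0..1}"
  defines "F \<equiv> 1 + real (inv_count S)"
  shows "pair_mean \<beta> p (\<lambda>n. ln (1 + real n)) S x \<le> ln F - \<beta> / F"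
proof -
  have x': "\<not> S x" "S (x + 1)" using x by (auto simp: pairs_01_def)
  define u v where "u = 1 + real (inv_count (S(x := True, x + 1 := True)))"
    and "v = 1 + real (inv_count (S(x := False, x + 1 := False)))"
  define q where "q = 1 + real (inv_count (S(x := S (x + 1), x + 1 := S x)))"
  have pos: "0 < u" "0 < v" "0 < F" "0 < q" by (simp_all add: u_def v_def F_def q_def)
  have sum: "u + v = 2 * F - 2"
    using inv_count_voter_01[OF S x'] by (simp add: u_def v_def F_def)
  have q: "q = F - 1"
    using inv_count_swap_01[OF S x'] x' by (simp add: q_def F_def)
  have "ln u + ln v \<le> 2 * ln F + ((u - F) / F + (v - F) / F)"
    using ln_le_tangent[OF pos(1,3)] ln_le_tangent[OF pos(2,3)] by simp
  also have "(u - F) / F + (v - F) / F = - 2 / F"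
    using sum by (simp add: add_divide_distrib[symmetric])
  finally have voter: "(ln u + ln v) / 2 \<le> ln F - 1 / F" by simp
  have "ln q \<le> ln F" using q pos by simp
  then have excl: "p * ln q + (1 - p) * ln F \<le> ln F"
    using p mult_left_mono[of "ln q" "ln F" p] by (simp add: algebra_simps)
  have "pair_mean \<beta> p (\<lambda>n. ln (1 + real n)) S x
      = \<beta> * ((ln u + ln v) / 2) + (1 - \<beta>) * (p * ln q + (1 - p) * ln F)"
    using x' by (simp add: pair_mean_def u_def v_def q_def F_def)
  also have "\<dots> \<le> \<beta> * (ln F - 1 / F) + (1 - \<beta>) * ln F"
    using \<beta> by (intro add_mono[OF mult_left_mono[OF voter] mult_left_mono[OF excl]]) auto
  finally show ?thesis by (simp add: algebra_simps)
qed

text \<open>The square is the second-order gain from concavity. It comes from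
  \<open>ln (F + d) + ln (F - d) = ln (F\<^sup>2 - d\<^sup>2)\<close>, with one tangent bound for the product; bounding the
  two logarithms separately by their tangents would lose it.\<close>
lemma pair_mean_ln_10:
  assumes S: "S \<in> step_like" and x: "x \<in> pairs_10 S"
    and p: "p \<in> {0..1}" and \<beta>: "\<beta> \<in> {0..1}"
  defines "F \<equiv> 1 + real (inv_count S)"
  shows "pair_mean \<beta> p (\<lambda>n. ln (1 + real n)) S x
    \<le> ln F + (1 - \<beta>) / F - \<beta> * (site_imbalance S x)\<^sup>2 / (2 * F\<^sup>2)"
proof -
  have x': "S x" "\<not> S (x + 1)" using x by (auto simp: pairs_10_def)
  define u v where "u = 1 + real (inv_count (S(x := True, x + 1 := True)))"
    and "v = 1 + real (inv_count (S(x := False, x + 1 := False)))"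
  define q where "q = 1 + real (inv_count (S(x := S (x + 1), x + 1 := S x)))"
  define d where "d = site_imbalance S x"
  have pos: "0 < u" "0 < v" "0 < F" "0 < q" by (simp_all add: u_def v_def F_def q_def)
  have uv: "u = F + d" "v = F - d"
    using inv_count_voter_10[OF S x'] by (simp_all add: u_def v_def F_def d_def)
  have q: "q = F + 1"
    using inv_count_swap_10[OF S x'] x' by (simp add: q_def F_def)
  have "ln u + ln v = ln (u * v)" using pos by (simp add: ln_mult)
  also have "\<dots> \<le> ln (F\<^sup>2) + (u * v - F\<^sup>2) / F\<^sup>2"
    using pos by (intro ln_le_tangent) auto
  also have "\<dots> = 2 * ln F - d\<^sup>2 / F\<^sup>2"
  proof -
    have "u * v - F\<^sup>2 = - d\<^sup>2" unfolding uv by (simp add: algebra_simps power2_eq_square)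
    moreover have "ln (F\<^sup>2) = 2 * ln F" using pos by (simp add: ln_realpow)
    ultimately show ?thesis by simp
  qed
  finally have voter: "(ln u + ln v) / 2 \<le> ln F - d\<^sup>2 / (2 * F\<^sup>2)"
    by (simp add: field_simps)
  have "ln q \<le> ln F + 1 / F" using ln_le_tangent[OF pos(4,3)] q by simp
  then have "(1 - p) * ln q + p * ln F \<le> (1 - p) * (ln F + 1 / F) + p * (ln F + 1 / F)"
    using p pos by (intro add_mono mult_left_mono) auto
  then have excl: "(1 - p) * ln q + p * ln F \<le> ln F + 1 / F"
    by (simp add: algebra_simps diff_divide_distrib)
  have "pair_mean \<beta> p (\<lambda>n. ln (1 + real n)) S x
      = \<beta> * ((ln u + ln v) / 2) + (1 - \<beta>) * ((1 - p) * ln q + p * ln F)"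
    using x' by (simp add: pair_mean_def u_def v_def q_def F_def)
  also have "\<dots> \<le> \<beta> * (ln F - d\<^sup>2 / (2 * F\<^sup>2)) + (1 - \<beta>) * (ln F + 1 / F)"
    using \<beta> by (intro add_mono[OF mult_left_mono[OF voter] mult_left_mono[OF excl]]) auto
  finally show ?thesis by (simp add: algebra_simps d_def diff_divide_distrib)
qed

text \<open>The two outermost pairs 10 suffice: their imbalances are, up to sign, the two factors of
  the bound on the number of inversions, and \<open>a\<^sup>2 + b\<^sup>2 \<ge> 2 a b\<close>.\<close>
lemma sum_imbalance_squares_ge:
  assumes S: "S \<in> step_like" and pos: "0 < inv_count S"
  shows "2 * real (inv_count S) \<le> (\<Sum>x\<in>pairs_10 S. (site_imbalance S x)\<^sup>2)"
proof -
  obtain l r where lr: "l \<in> pairs_10 S" "r \<in> pairs_10 S" "l \<noteq> r"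
    "zeros_left S l = {}" "ones_right S r = {}"
    "inv_count S \<le> card (zeros_left S r) * card (ones_right S l)"
    using outermost_pairs_10[OF assms] by metis
  let ?a = "real (card (zeros_left S r))" and ?b = "real (card (ones_right S l))"
  have "real (inv_count S) \<le> real (card (zeros_left S r) * card (ones_right S l))"
    using lr(6) by (simp only: of_nat_le_iff)
  then have "2 * real (inv_count S) \<le> 2 * ?a * ?b" by simp
  also have "\<dots> \<le> ?a\<^sup>2 + ?b\<^sup>2" by (rule sum_squares_bound)
  also have "\<dots> = (\<Sum>x\<in>{l, r}. (site_imbalance S x)\<^sup>2)"
    using lr(3-5) by (simp add: site_imbalance_def)
  also have "\<dots> \<le> (\<Sum>x\<in>pairs_10 S. (site_imbalance S x)\<^sup>2)"
    using lr(1,2) by (intro sum_mono2 finite_pairs S) auto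
  finally show ?thesis .
qed

lemma ln_inversions_drift:
  assumes p: "p \<in> {0..1}" and \<beta>: "\<beta> \<in> {4/7..1}" and c: "c \<noteq> ground_state"
  shows "measure_pmf.expectation (step \<beta> p c) (\<lambda>c'. ln (1 + real (inversions c'))) \<le> ln (1 + real (inversions c))"
proof -
  have \<beta>01: "\<beta> \<in> {0..1}" using \<beta> by auto
  obtain S where S: "S \<in> step_like" and c_eq: "c = abs_config S" by (rule config_cases)
  have I_pos: "0 < inv_count S"
    using inversions_eq_0D[of c] c inversions_abs[OF S] unfolding c_eq by auto
  define F where "F = 1 + real (inv_count S)"
  define N where "N = real (card (pairs_01 S))"
  have F: "2 \<le> F" using I_pos by (simp add: F_def)
  have "pairs_01 S \<noteq> {}" using outermost_pairs_10[OF S I_pos] by metis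
  then have N: "1 \<le> N" using finite_pairs(2)[OF S] by (simp add: N_def Suc_le_eq card_gt_0_iff)
  have card10: "real (card (pairs_10 S)) = N + 1" using card_pairs_10[OF S] by (simp add: N_def)
  have card: "real (card (unlike_pairs S)) = 2 * N + 1"
    unfolding unlike_pairs_split(1)
    using card_Un_disjoint[OF finite_pairs[OF S] unlike_pairs_split(2)] card10 by (simp add: N_def)
  let ?m = "pair_mean \<beta> p (\<lambda>n. ln (1 + real n)) S"
  define D where "D = (\<Sum>x\<in>pairs_10 S. (site_imbalance S x)\<^sup>2)"
  have D: "2 * (F - 1) \<le> D"
    using sum_imbalance_squares_ge[OF S I_pos] by (simp add: D_def F_def)
  have "(\<Sum>x\<in>unlike_pairs S. ?m x) = (\<Sum>x\<in>pairs_10 S. ?m x) + (\<Sum>x\<in>pairs_01 S. ?m x)"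
    unfolding unlike_pairs_split(1) by (rule sum.union_disjoint[OF finite_pairs[OF S] unlike_pairs_split(2)])
  also have "\<dots> \<le> (\<Sum>x\<in>pairs_10 S. ln F + (1 - \<beta>) / F - \<beta> * (site_imbalance S x)\<^sup>2 / (2 * F\<^sup>2))
      + (\<Sum>x\<in>pairs_01 S. ln F - \<beta> / F)"
    unfolding F_def by (intro add_mono sum_mono pair_mean_ln_10 pair_mean_ln_01 S p \<beta>01)
  also have "\<dots> = (2 * N + 1) * ln F + ((N + 1) * (1 - \<beta>) - N * \<beta>) / F - \<beta> * D / (2 * F\<^sup>2)"
  proof -
    have "(\<Sum>x\<in>pairs_10 S. ln F + (1 - \<beta>) / F - \<beta> * (site_imbalance S x)\<^sup>2 / (2 * F\<^sup>2))
        = (N + 1) * (ln F + (1 - \<beta>) / F) - \<beta> * D / (2 * F\<^sup>2)"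
      unfolding D_def sum_distrib_left sum_divide_distrib sum_subtractf sum_constant card10 ..
    moreover have "(\<Sum>x\<in>pairs_01 S. ln F - \<beta> / F) = N * (ln F - \<beta> / F)"
      by (simp add: N_def)
    ultimately show ?thesis by (simp add: algebra_simps add_divide_distrib diff_divide_distrib)
  qed
  also have "\<dots> \<le> (2 * N + 1) * ln F"
  proof -
    \<comment> \<open>This sum is \<open>(2 \<beta> - 1) (N + 1) F - \<beta>\<close>, decomposed around the extreme case \<open>N = 1\<close>, \<open>F = 2\<close>;
      its first term is where \<open>\<beta> \<ge> 4/7\<close> is needed.\<close>
    have "0 \<le> (7 * \<beta> - 4) * F / 2 + (2 * \<beta> - 1) * (N - 1) * F + \<beta> * (F - 2) / 2"
      using \<beta> N F by (intro add_nonneg_nonneg) auto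
    then have "((N + 1) * (1 - \<beta>) - N * \<beta>) * F \<le> \<beta> * (F - 1)"
      by (simp add: field_simps)
    also have "\<dots> \<le> \<beta> * D / 2"
      using D \<beta> mult_left_mono[OF D, of \<beta>] by simp
    finally have "((N + 1) * (1 - \<beta>) - N * \<beta>) * F / F\<^sup>2 \<le> \<beta> * D / 2 / F\<^sup>2"
      by (rule divide_right_mono) simp
    then show ?thesis using F by (simp add: power2_eq_square)
  qed
  finally have "(\<Sum>x\<in>unlike_pairs S. ?m x) / card (unlike_pairs S) \<le> ln F"
    using N card by (simp add: field_simps)
  then show ?thesis
    using expectation_step[OF p \<beta>01 S, of "\<lambda>n. ln (1 + real n)"] S
    by (simp add: c_eq inversions_abs F_def)
qed

text \<open>No 0 lies to the left of the leftmost pair 10, so replacing that pair by 11 removes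
  inversions and creates none. There are at most \<open>2 I + 1\<close> unlike pairs, because every pair 01
  is itself an inversion; so the chance of this voter move is bounded below in terms of \<open>I\<close>.\<close>
lemma inversions_decrease:
  assumes p: "p \<in> {0..1}" and \<beta>: "\<beta> \<in> {0..1}" and c: "c \<noteq> ground_state"
  shows "\<beta> / 2 / (2 * real (inversions c) + 1)
    \<le> measure_pmf.prob (step \<beta> p c) {c'. inversions c' < inversions c}"
proof -
  obtain S where S: "S \<in> step_like" and c_eq: "c = abs_config S" by (rule config_cases)
  have I_pos: "0 < inv_count S"
    using inversions_eq_0D[of c] c inversions_abs[OF S] unfolding c_eq by auto
  define \<phi> where "\<phi> n = (of_bool (n < inv_count S) :: real)" for n
  let ?m = "pair_mean \<beta> p \<phi> S"
  have \<phi>: "0 \<le> \<phi> n" for n by (simp add: \<phi>_def)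
  have m: "0 \<le> ?m x" for x
    unfolding pair_mean_def Let_def
    using p \<beta> \<phi> by (intro add_nonneg_nonneg mult_nonneg_nonneg) auto
  obtain l r where lr: "l \<in> pairs_10 S" "zeros_left S l = {}"
    "inv_count S \<le> card (zeros_left S r) * card (ones_right S l)"
    using outermost_pairs_10[OF S I_pos] by metis
  have "0 < card (ones_right S l)" using lr(3) I_pos by (cases "card (ones_right S l)") auto
  moreover have "S l" "\<not> S (l + 1)" using lr(1) by (auto simp: pairs_10_def)
  ultimately have "inv_count (S(l := True, l + 1 := True)) < inv_count S"
    using inv_count_voter_10(2)[OF S, of l] lr(2) by (simp add: site_imbalance_def)
  then have one: "\<phi> (inv_count (S(l := True, l + 1 := True))) = 1"
    by (simp add: \<phi>_def)
  have "\<beta> * (1 / 2) + (1 - \<beta>) * 0 \<le> ?m l"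
    unfolding pair_mean_def Let_def one using p \<beta> \<phi>
    by (intro add_mono mult_left_mono add_nonneg_nonneg mult_nonneg_nonneg) auto
  also have "?m l \<le> (\<Sum>x\<in>unlike_pairs S. ?m x)"
    using lr(1) m by (intro member_le_sum finite_unlike_pairs S) (auto simp: unlike_pairs_split(1))
  finally have sum: "\<beta> / 2 \<le> (\<Sum>x\<in>unlike_pairs S. ?m x)" by simp
  have "card (unlike_pairs S) = card (pairs_10 S) + card (pairs_01 S)"
    unfolding unlike_pairs_split(1) by (rule card_Un_disjoint[OF finite_pairs[OF S] unlike_pairs_split(2)])
  then have "card (unlike_pairs S) \<le> 2 * inv_count S + 1"
    using card_pairs_10[OF S] card_pairs_01_le[OF S] by simp
  then have card: "real (card (unlike_pairs S)) \<le> 2 * real (inv_count S) + 1"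
    by linarith
  have card_pos: "0 < real (card (unlike_pairs S))"
    using finite_unlike_pairs[OF S] unlike_pairs_nonempty[OF S] by (simp add: card_gt_0_iff)
  have "\<beta> / 2 / (2 * real (inv_count S) + 1) \<le> (\<Sum>x\<in>unlike_pairs S. ?m x) / card (unlike_pairs S)"
    using sum card card_pos \<beta> by (intro frac_le) auto
  also have "\<dots> = measure_pmf.expectation (step \<beta> p c) (\<lambda>c'. \<phi> (inversions c'))"
    unfolding c_eq by (rule expectation_step[OF p \<beta> S, symmetric])
  also have "(\<lambda>c'. \<phi> (inversions c')) = indicator {c'. inversions c' < inversions c}"
    using inversions_abs[OF S] by (auto simp: \<phi>_def c_eq indicator_def fun_eq_iff)
  finally show ?thesis using inversions_abs[OF S] by (simp add: c_eq)
qed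

section \<open>Recurrence\<close>

lemma avoid_ground_state_tendsto_0:
  assumes p: "p \<in> {0..1}" and \<beta>: "\<beta> \<in> {4/7..1}"
  shows "(\<lambda>n. avoid (step \<beta> p) ground_state n c) \<longlonglongrightarrow> 0"
proof (rule avoid_tendsto_0[where f = inversions and H = "\<lambda>n. ln (1 + real n)"
      and \<delta> = "\<lambda>n. \<beta> / 2 / (2 * real n + 1)"])
  show "filterlim (\<lambda>n. ln (1 + real n)) at_top sequentially"
    by real_asymp
  show "integrable (step \<beta> p c) (\<lambda>y. ln (1 + real (inversions y)))" for c
    by (rule integrable_measure_pmf_finite[OF finite_set_step])
  show "\<beta> / 2 / (2 * real (inversions c) + 1)
      \<le> measure_pmf.prob (step \<beta> p c) {y. inversions y < inversions c}"
    if "c \<noteq> ground_state" for c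
    by (rule inversions_decrease[OF p _ that]) (use \<beta> in auto)
qed (use \<beta> ln_inversions_drift[OF p \<beta>] in auto)

lemma relaxation_time_finite_iff:
  "relaxation_time \<xi> \<omega> < \<infinity> \<longleftrightarrow> (\<exists>t\<ge>1. \<xi> t \<omega> = ground_state)"
  unfolding relaxation_time_def INF_less_iff by auto

theorem theorem4:
  fixes \<beta> p :: real and M :: "'w measure" and \<xi> :: "nat \<Rightarrow> 'w \<Rightarrow> config" and S\<^sub>0 :: config
  assumes "p \<in> {0..<1/2}" and "\<beta> \<in> {4/7..1}"
    and "exclusion_voter \<beta> p M \<xi>"
    and "\<P>(\<omega> in M. \<xi> 0 \<omega> = S\<^sub>0) > 0"
  shows "\<P>(\<omega> in M. relaxation_time \<xi> \<omega> < \<infinity> \<bar> \<xi> 0 \<omega> = S\<^sub>0) = 1"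
proof -
  have "(\<lambda>n. avoid (step \<beta> p) ground_state n c) \<longlonglongrightarrow> 0" for c
    using assms(1,2) by (intro avoid_ground_state_tendsto_0) auto
  then show ?thesis
    unfolding relaxation_time_finite_iff
    using assms(3,4) unfolding exclusion_voter_def by (intro markov_chain_returns)
qed

end
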